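(* Let $E,A\in\mathbb{R}^{k\times k}$ with $A$ invertible, let $B\in\mathbb{R}^{k\times m}$, and set $M(s)=Es-A$, $N(s)=B$. Assume that the system $M(s)\hat y=N(s)\hat u+\hat w$ is causal and well-posed and that $j\omega E-A$ is nonsingular for all $\omega\in\mathbb{R}$. Define $$K=B^TA^{-T},\qquad F=EA^T,\qquad G=AA^T+BB^T .$$ If the minimal realization of $(E,\,A+BB^TA^{-T})$ is Hurwitz and $$\omega^2FG^{-1}F^T+j\omega(F^T-F)+G\succeq\|G^{-1}\|^{-1}I\qquad\text{for all }\omega\in\mathbb{R},$$ then $K$ solves the $H_\infty$ optimal control problem $$\inf_{\tilde K\in RL_\infty}\left\|\begin{bmatrix} I\\ \tilde K\end{bmatrix}(M-N\tilde K)^{-1}\right\|_\infty .$$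
   Context: Here $j$ is the imaginary unit, $A^{-T}=(A^{-1})^T$, $\|\cdot\|$ applied to a matrix is the spectral norm, and $X\succeq Y$ for Hermitian matrices means $X-Y$ is positive semidefinite. $RH_\infty$ is the set of proper real rational stable transfer matrices (all poles in the open left half plane), with norm $\|H\|_\infty=\sup_{\mathrm{Re}(s)>0}\|H(s)\|=\sup_{\omega\in\mathbb{R}}\|H(j\omega)\|$. $RL_\infty$ is the set of proper real rational matrix functions with no poles on the imaginary axis; controllers $\tilde K\in RL_\infty$ have size $m\times k$. Realizability of the system means that $M^{-1}$ and $M^{-1}N$ are proper. "The minimal realization of $(E,\tilde A)$ is Hurwitz" means that $(Es-\tilde A)^{-1}$ is stable: it exists, is proper, and the state matrix of a minimal state-space realization of it has all eigenvalues with negative real part, i.e. $(Es-\tilde A)^{-1}\in RH_\infty$. The problem is to find a stabilizing controller $\hat u=\tilde K\hat y$ minimizing the $H_\infty$ norm of the closed-loop map from $w$ to $(y,u)$. The infimum is over $\tilde K\in RL_\infty$ that are stabilizing, i.e. $M-N\tilde K$ is invertible as a rational matrix with $(M-N\tilde K)^{-1}\in RH_\infty$; the value is $\infty$ if there is no such $\tilde K$. A matrix "solves" the problem if it is feasible (stabilizing) and attains the infimum. *)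

theory Defs
  imports
    "HOL-Analysis.Analysis"
    "HOL-Computational_Algebra.Field_as_Ring"
    "HOL-Computational_Algebra.Polynomial_Factorial"
    "HOL-Computational_Algebra.Normalized_Fraction"
begin

section \<open>Real rational functions\<close>

type_synonym ratfun = "real poly fract"

definition rf_num :: "ratfun \<Rightarrow> real poly" where
  "rf_num f = fst (quot_of_fract f)"

definition rf_den :: "ratfun \<Rightarrow> real poly" where
  "rf_den f = snd (quot_of_fract f)"

text \<open>Numerator and denominator are in lowest terms, so that the complex roots of the denominator
  are exactly the poles. The value at a pole is the conventional \<open>x / 0 = 0\<close>.\<close>

definition rf_pole :: "ratfun \<Rightarrow> complex \<Rightarrow> bool" where
  "rf_pole f z \<longleftrightarrow> poly (map_poly complex_of_real (rf_den f)) z = 0"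

definition rf_eval :: "ratfun \<Rightarrow> complex \<Rightarrow> complex" where
  "rf_eval f z = poly (map_poly complex_of_real (rf_num f)) z
               / poly (map_poly complex_of_real (rf_den f)) z"

definition rf_proper :: "ratfun \<Rightarrow> bool" where
  "rf_proper f \<longleftrightarrow> degree (rf_num f) \<le> degree (rf_den f)"

definition rf_const :: "real \<Rightarrow> ratfun" where
  "rf_const c = to_fract [:c:]"

definition rf_s :: ratfun where
  "rf_s = to_fract [:0, 1:]"


section \<open>Matrices\<close>

definition scale_mat :: "'a::times \<Rightarrow> 'a^'n^'m \<Rightarrow> 'a^'n^'m" (infixr \<open>*\<^sub>m\<close> 75) where
  "c *\<^sub>m X = (\<chi> i j. c * X $ i $ j)"

definition vstack :: "'a^'n^'p \<Rightarrow> 'a^'n^'q \<Rightarrow> 'a^'n^('p + 'q)" where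
  "vstack X Y = (\<chi> i. case i of Inl a \<Rightarrow> X $ a | Inr b \<Rightarrow> Y $ b)"

definition cmat :: "real^'n^'m \<Rightarrow> complex^'n^'m" where
  "cmat X = (\<chi> i j. complex_of_real (X $ i $ j))"

definition rmat :: "real^'n^'m \<Rightarrow> ratfun^'n^'m" where
  "rmat X = (\<chi> i j. rf_const (X $ i $ j))"

text \<open>The operator norm induced by the Euclidean norms, that is, the spectral norm.\<close>

definition spectral_norm :: "'a::real_normed_field^'n^'m \<Rightarrow> real" where
  "spectral_norm X = onorm ((*v) X)"

definition hermitian :: "complex^'n^'n \<Rightarrow> bool" where
  "hermitian X \<longleftrightarrow> (\<forall>i j. X $ i $ j = cnj (X $ j $ i))"

definition psd :: "complex^'n^'n \<Rightarrow> bool" where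
  "psd X \<longleftrightarrow> hermitian X \<and> (\<forall>v. 0 \<le> Re (\<Sum>i\<in>UNIV. cnj (v $ i) * (X *v v) $ i))"

definition loewner_ge :: "complex^'n^'n \<Rightarrow> complex^'n^'n \<Rightarrow> bool" (infix \<open>\<succeq>\<close> 50) where
  "X \<succeq> Y \<longleftrightarrow> psd (X - Y)"


section \<open>Real rational transfer matrices\<close>

definition eval_mat :: "ratfun^'n^'m \<Rightarrow> complex \<Rightarrow> complex^'n^'m" where
  "eval_mat H z = (\<chi> i j. rf_eval (H $ i $ j) z)"

definition proper_mat :: "ratfun^'n^'m \<Rightarrow> bool" where
  "proper_mat H \<longleftrightarrow> (\<forall>i j. rf_proper (H $ i $ j))"

definition RL_inf :: "(ratfun^'n^'m) set" where
  "RL_inf = {H. proper_mat H \<and> (\<forall>i j z. rf_pole (H $ i $ j) z \<longrightarrow> Re z \<noteq> 0)}"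

definition RH_inf :: "(ratfun^'n^'m) set" where
  "RH_inf = {H. proper_mat H \<and> (\<forall>i j z. rf_pole (H $ i $ j) z \<longrightarrow> Re z < 0)}"

text \<open>The supremum is infinite for every \<open>H\<close> outside \<open>RH_inf\<close>: an entry that is not proper is
  unbounded at infinity, and an entry with a pole in the closed right half plane is unbounded
  near it, so the conventional value at the pole itself does not matter.\<close>

definition Hinf_norm :: "ratfun^'n^'m \<Rightarrow> ereal" where
  "Hinf_norm H = (SUP z\<in>{z. Re z > 0}. ereal (spectral_norm (eval_mat H z)))"

definition realizable :: "ratfun^'k^'k \<Rightarrow> ratfun^'m^'k \<Rightarrow> bool" where
  "realizable M N \<longleftrightarrow>
     invertible M \<and> proper_mat (matrix_inv M) \<and> proper_mat (matrix_inv M ** N)"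


section \<open>State-space realizations\<close>

text \<open>The state dimension \<open>n\<close> is quantified over below, so the state is indexed by \<open>{..<n}\<close>;
  entries of \<open>A\<close>, \<open>B\<close>, \<open>C\<close> with a state index \<open>\<ge> n\<close> are irrelevant. The matrix \<open>X\<close> is
  \<open>(s I - A)\<^sup>-\<^sup>1 B\<close>, which is unique because \<open>s I - A\<close> is invertible over the rational functions.
  Hence the condition says \<open>H = C (s I - A)\<^sup>-\<^sup>1 B + D\<close>.\<close>

definition realization ::
  "nat \<Rightarrow> (nat \<Rightarrow> nat \<Rightarrow> real) \<Rightarrow> (nat \<Rightarrow> 'q \<Rightarrow> real) \<Rightarrow> ('p \<Rightarrow> nat \<Rightarrow> real) \<Rightarrow> real^'q^'p
     \<Rightarrow> ratfun^'q^'p \<Rightarrow> bool" where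
  "realization n A B C D H \<longleftrightarrow>
     (\<exists>X :: nat \<Rightarrow> 'q \<Rightarrow> ratfun.
        (\<forall>i<n. \<forall>q. rf_s * X i q - (\<Sum>l<n. rf_const (A i l) * X l q) = rf_const (B i q)) \<and>
        (\<forall>p q. H $ p $ q = (\<Sum>i<n. rf_const (C p i) * X i q) + rf_const (D $ p $ q)))"

definition minimal_realization ::
  "nat \<Rightarrow> (nat \<Rightarrow> nat \<Rightarrow> real) \<Rightarrow> (nat \<Rightarrow> 'q \<Rightarrow> real) \<Rightarrow> ('p \<Rightarrow> nat \<Rightarrow> real) \<Rightarrow> real^'q^'p
     \<Rightarrow> ratfun^'q^'p \<Rightarrow> bool" where
  "minimal_realization n A B C D H \<longleftrightarrow>
     realization n A B C D H \<and> (\<forall>n' A' B' C' D'. realization n' A' B' C' D' H \<longrightarrow> n \<le> n')"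

definition state_eigenvalue :: "nat \<Rightarrow> (nat \<Rightarrow> nat \<Rightarrow> real) \<Rightarrow> complex \<Rightarrow> bool" where
  "state_eigenvalue n A z \<longleftrightarrow>
     (\<exists>v :: nat \<Rightarrow> complex. (\<exists>i<n. v i \<noteq> 0) \<and>
        (\<forall>i<n. (\<Sum>l<n. complex_of_real (A i l) * v l) = z * v i))"

text \<open>Minimal realizations are unique up to a change of basis of the state, so asking for some
  or for every minimal realization makes no difference.\<close>

definition minimal_realization_hurwitz :: "real^'k^'k \<Rightarrow> real^'k^'k \<Rightarrow> bool" where
  "minimal_realization_hurwitz E A \<longleftrightarrow>
     (let P = rf_s *\<^sub>m rmat E - rmat A in
        invertible P \<and> proper_mat (matrix_inv P) \<and>
        (\<exists>n A' B' C' D'. minimal_realization n A' B' C' D' (matrix_inv P) \<and>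
           (\<forall>z. state_eigenvalue n A' z \<longrightarrow> Re z < 0)))"


section \<open>The optimal control problem\<close>

definition stabilizing :: "ratfun^'k^'k \<Rightarrow> ratfun^'m^'k \<Rightarrow> ratfun^'k^'m \<Rightarrow> bool" where
  "stabilizing M N K \<longleftrightarrow> invertible (M - N ** K) \<and> matrix_inv (M - N ** K) \<in> RH_inf"

definition closed_loop :: "ratfun^'k^'k \<Rightarrow> ratfun^'m^'k \<Rightarrow> ratfun^'k^'m \<Rightarrow> ratfun^'k^('k + 'm)" where
  "closed_loop M N K = vstack (mat 1) K ** matrix_inv (M - N ** K)"

definition feasible :: "ratfun^'k^'k \<Rightarrow> ratfun^'m^'k \<Rightarrow> (ratfun^'k^'m) set" where
  "feasible M N = {K \<in> RL_inf. stabilizing M N K}"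

definition Hinf_optimum :: "ratfun^'k^'k \<Rightarrow> ratfun^'m^'k \<Rightarrow> ereal" where
  "Hinf_optimum M N = (INF K\<in>feasible M N. Hinf_norm (closed_loop M N K))"

definition solves_Hinf_problem :: "ratfun^'k^'k \<Rightarrow> ratfun^'m^'k \<Rightarrow> ratfun^'k^'m \<Rightarrow> bool" where
  "solves_Hinf_problem M N K \<longleftrightarrow>
     K \<in> feasible M N \<and> Hinf_norm (closed_loop M N K) = Hinf_optimum M N"

end

theory Submission
  imports Defs "HOL-Complex_Analysis.Conformal_Mappings"
begin

text \<open>Both bounds come down to one number, \<open>\<gamma> = \<parallel>G\<^sup>-\<^sup>1\<parallel>\<close>: the closed loop of \<open>K\<close> has norm at most
  \<open>sqrt \<gamma>\<close>, and the closed loop of no feasible controller has norm below \<open>sqrt \<gamma>\<close> at the single point \<open>s = 0\<close>.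

  Upper bound. With \<open>K = B\<^sup>T A\<^sup>-\<^sup>T\<close> one has \<open>M - N K = (F s - G) A\<^sup>-\<^sup>T\<close>, so the closed loop is
  \<open>T = L (F s - G)\<^sup>-\<^sup>1\<close>, where \<open>L\<close> is \<open>A\<^sup>T\<close> stacked on \<open>B\<^sup>T\<close> and \<open>L\<^sup>* L = G\<close>. Hence
  \<open>T\<^sup>* T\<close> is the inverse of \<open>D G\<^sup>-\<^sup>1 D\<^sup>*\<close> with \<open>D = F s - G\<close>. On \<open>s = \<i> \<omega>\<close> the latter matrix expands
  to the left-hand side of the assumed matrix inequality, which therefore says exactly that
  \<open>T\<^sup>* T\<close> is at most \<open>\<gamma> I\<close> on the imaginary axis (lemma \<open>gain_upper_bound\<close>). Since \<open>T\<close> is proper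
  and has no poles in the closed right half plane, the maximum modulus principle extends the
  bound to the open right half plane (lemma \<open>RH_inf_gain_bound\<close>).

  Lower bound. For any feasible \<open>K'\<close>, the two blocks \<open>X\<close> and \<open>Y\<close> of the closed loop satisfy
  \<open>M X - N Y = I\<close>, which at \<open>s = 0\<close> reads \<open>A X + B Y = - I\<close>. The right inverse
  of \<open>[A B]\<close> of least norm is \<open>L G\<^sup>-\<^sup>1\<close>, whose Gram matrix is \<open>G\<^sup>-\<^sup>1\<close>; so the closed loop has norm at
  least \<open>sqrt \<gamma>\<close> at \<open>0\<close> (lemma \<open>gain_lower_bound\<close>), and \<open>0\<close> is a limit of points of the open right
  half plane (lemma \<open>Hinf_norm_bound\<close>).

  Feasibility of \<open>K\<close>. A rational matrix has no poles outside the spectrum of the state matrix of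
  any of its realizations (lemma \<open>realization_no_pole\<close>); applied to a Hurwitz minimal
  realization of \<open>(E s - A - B K)\<^sup>-\<^sup>1\<close> this gives membership in \<open>RH_inf\<close>.\<close>

section \<open>Values and poles of real rational functions\<close>

definition cpoly :: "real poly \<Rightarrow> complex poly" where
  "cpoly p = map_poly complex_of_real p"

lemma cpoly_0 [simp]: "cpoly 0 = 0" and cpoly_1 [simp]: "cpoly 1 = 1"
  by (simp_all add: cpoly_def)

lemma cpoly_pCons [simp]: "cpoly (pCons c p) = pCons (of_real c) (cpoly p)"
  by (simp add: cpoly_def map_poly_pCons)

lemma cpoly_add [simp]: "cpoly (p + q) = cpoly p + cpoly q"
  by (rule poly_eqI) (simp add: cpoly_def coeff_map_poly)

lemma cpoly_diff [simp]: "cpoly (p - q) = cpoly p - cpoly q"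
  by (rule poly_eqI) (simp add: cpoly_def coeff_map_poly)

lemma cpoly_smult [simp]: "cpoly (smult c p) = smult (of_real c) (cpoly p)"
  by (rule poly_eqI) (simp add: cpoly_def coeff_map_poly)

lemma cpoly_mult [simp]: "cpoly (p * q) = cpoly p * cpoly q"
  by (rule poly_eqI) (simp add: cpoly_def coeff_map_poly coeff_mult)

lemma cpoly_sum [simp]: "cpoly (sum f I) = (\<Sum>i\<in>I. cpoly (f i))"
  by (induction I rule: infinite_finite_induct) auto

lemma cpoly_eq_0_iff [simp]: "cpoly p = 0 \<longleftrightarrow> p = 0"
  by (simp add: cpoly_def map_poly_eq_0_iff)

lemma degree_cpoly [simp]: "degree (cpoly p) = degree p"
  unfolding cpoly_def by (rule degree_map_poly) simp

lemma rf_den_nonzero [simp]: "rf_den f \<noteq> 0"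
  by (simp add: rf_den_def)

lemma rf_num_den: "f = to_fract (rf_num f) / to_fract (rf_den f)"
  unfolding rf_num_def rf_den_def by (metis Fract_conv_to_fract Fract_quot_of_fract)

lemma coprime_rf_num_den: "coprime (rf_num f) (rf_den f)"
  unfolding rf_num_def rf_den_def by (rule coprime_quot_of_fract)

lemma rf_pole_iff: "rf_pole f z \<longleftrightarrow> poly (cpoly (rf_den f)) z = 0"
  by (simp add: rf_pole_def cpoly_def)

lemma rf_eval_eq: "rf_eval f z = poly (cpoly (rf_num f)) z / poly (cpoly (rf_den f)) z"
  by (simp add: rf_eval_def cpoly_def)

lemma rf_num_den_cross:
  assumes "f = to_fract p / to_fract q" "q \<noteq> 0"
  shows "rf_num f * q = p * rf_den f"
proof -
  have "to_fract (rf_num f) / to_fract (rf_den f) = to_fract p / to_fract q"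
    using assms rf_num_den by metis
  then have "to_fract (rf_num f * q) = to_fract (p * rf_den f)"
    using assms(2) by (simp add: field_simps)
  then show ?thesis by (simp only: to_fract_eq_iff)
qed

lemma rf_num_nonzero_at_pole:
  assumes "rf_pole f z"
  shows "poly (cpoly (rf_num f)) z \<noteq> 0"
proof
  assume num: "poly (cpoly (rf_num f)) z = 0"
  obtain a b where "a * rf_num f + b * rf_den f = 1"
    using bezout_coefficients_fst_snd[of "rf_num f" "rf_den f"] coprime_rf_num_den[of f]
    by (metis coprime_imp_gcd_eq_1)
  from arg_cong[OF this, of "\<lambda>p. poly (cpoly p) z"] show False
    using num assms by (simp add: rf_pole_iff)
qed

text \<open>The definitions of poles and values refer to the fraction in lowest terms. The denominator in
  lowest terms divides every other denominator, so any fraction whose denominator does not vanish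
  at \<open>z\<close> may be used instead. This is what makes evaluation at a regular point
  compatible with the ring operations.\<close>

lemma fraction_eval:
  assumes f: "f = to_fract p / to_fract q" and q: "poly (cpoly q) z \<noteq> 0"
  shows "\<not> rf_pole f z" "rf_eval f z = poly (cpoly p) z / poly (cpoly q) z"
proof -
  have "q \<noteq> 0" using q by auto
  with f have eq: "rf_num f * q = p * rf_den f" by (rule rf_num_den_cross)
  then have "rf_den f dvd rf_num f * q" by simp
  then have "rf_den f dvd q"
    using coprime_rf_num_den by (metis coprime_commute coprime_dvd_mult_right_iff)
  then obtain r where "q = rf_den f * r" by blast
  then show np: "\<not> rf_pole f z" using q by (auto simp: rf_pole_iff)
  have "poly (cpoly (rf_num f)) z * poly (cpoly q) z = poly (cpoly p) z * poly (cpoly (rf_den f)) z"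
    using arg_cong[OF eq, of "\<lambda>p. poly (cpoly p) z"] by simp
  then show "rf_eval f z = poly (cpoly p) z / poly (cpoly q) z"
    using np q by (simp add: rf_eval_eq rf_pole_iff field_simps)
qed

lemma
  shows rf_pole_to_fract [simp]: "\<not> rf_pole (to_fract p) z"
    and rf_eval_to_fract: "rf_eval (to_fract p) z = poly (cpoly p) z"
  using fraction_eval[of "to_fract p" p 1 z] by simp_all

lemma
  shows rf_pole_const [simp]: "\<not> rf_pole (rf_const c) z"
    and rf_eval_const [simp]: "rf_eval (rf_const c) z = of_real c"
    and rf_pole_s [simp]: "\<not> rf_pole rf_s z"
    and rf_eval_s [simp]: "rf_eval rf_s z = z"
    and rf_eval_0 [simp]: "rf_eval 0 z = 0"
    and rf_pole_0 [simp]: "\<not> rf_pole 0 z"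
  using rf_pole_to_fract[of 0 z] rf_eval_to_fract[of 0 z]
  by (simp_all add: rf_const_def rf_s_def rf_eval_to_fract)

lemma
  assumes "\<not> rf_pole f z" "\<not> rf_pole g z"
  shows rf_pole_add: "\<not> rf_pole (f + g) z"
    and rf_eval_add: "rf_eval (f + g) z = rf_eval f z + rf_eval g z"
    and rf_pole_diff: "\<not> rf_pole (f - g) z"
    and rf_eval_diff: "rf_eval (f - g) z = rf_eval f z - rf_eval g z"
    and rf_pole_mult: "\<not> rf_pole (f * g) z"
    and rf_eval_mult: "rf_eval (f * g) z = rf_eval f z * rf_eval g z"
proof -
  define a b c d where "a = rf_num f" and "b = rf_den f" and "c = rf_num g" and "d = rf_den g"
  note defs = a_def b_def c_def d_def
  have nz: "poly (cpoly b) z \<noteq> 0" "poly (cpoly d) z \<noteq> 0"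
    using assms by (auto simp: rf_pole_iff defs)
  then have nz': "poly (cpoly (b * d)) z \<noteq> 0" by simp
  have bd: "to_fract b \<noteq> 0" "to_fract d \<noteq> 0" by (simp_all add: defs)
  have f: "f = to_fract a / to_fract b" and g: "g = to_fract c / to_fract d"
    unfolding defs by (rule rf_num_den)+
  have ev: "rf_eval f z = poly (cpoly a) z / poly (cpoly b) z"
    "rf_eval g z = poly (cpoly c) z / poly (cpoly d) z"
    by (simp_all add: rf_eval_eq defs)
  have add: "f + g = to_fract (a * d + c * b) / to_fract (b * d)"
    and diff: "f - g = to_fract (a * d - c * b) / to_fract (b * d)"
    and mult: "f * g = to_fract (a * c) / to_fract (b * d)"
    unfolding f g using bd by (simp_all add: field_simps)
  show "\<not> rf_pole (f + g) z" "\<not> rf_pole (f - g) z" "\<not> rf_pole (f * g) z"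
    using fraction_eval(1)[OF add nz'] fraction_eval(1)[OF diff nz'] fraction_eval(1)[OF mult nz']
    by simp_all
  show "rf_eval (f + g) z = rf_eval f z + rf_eval g z"
    "rf_eval (f - g) z = rf_eval f z - rf_eval g z"
    "rf_eval (f * g) z = rf_eval f z * rf_eval g z"
    by (simp_all only: fraction_eval(2)[OF add nz'] fraction_eval(2)[OF diff nz']
        fraction_eval(2)[OF mult nz'] ev cpoly_add cpoly_diff cpoly_mult poly_add poly_diff
        poly_mult add_frac_eq[OF nz] diff_frac_eq[OF nz] times_divide_times_eq)
qed

lemma rf_pole_eval_sum:
  assumes "\<And>i. i \<in> I \<Longrightarrow> \<not> rf_pole (f i) z"
  shows "\<not> rf_pole (sum f I) z \<and> rf_eval (sum f I) z = (\<Sum>i\<in>I. rf_eval (f i) z)"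
  using assms
  by (induction I rule: infinite_finite_induct) (auto simp: rf_pole_add rf_eval_add)

lemmas rf_pole_sum = rf_pole_eval_sum[THEN conjunct1]
  and rf_eval_sum = rf_pole_eval_sum[THEN conjunct2]

lemma rf_const_add: "rf_const (a + b) = rf_const a + rf_const b"
  and rf_const_mult: "rf_const (a * b) = rf_const a * rf_const b"
  by (simp_all add: rf_const_def flip: to_fract_add to_fract_mult)

lemma rf_const_0 [simp]: "rf_const 0 = 0" and rf_const_1 [simp]: "rf_const 1 = 1"
  by (simp_all add: rf_const_def one_pCons[symmetric])

lemma rf_const_sum: "rf_const (sum f I) = (\<Sum>i\<in>I. rf_const (f i))"
  by (induction I rule: infinite_finite_induct) (auto simp: rf_const_add)

lemma rf_eval_holomorphic:
  assumes "\<And>z. z \<in> S \<Longrightarrow> \<not> rf_pole f z"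
  shows "rf_eval f holomorphic_on S"
  unfolding rf_eval_eq[abs_def] using assms by (intro holomorphic_intros) (auto simp: rf_pole_iff)

lemma rf_eval_isCont:
  assumes "\<not> rf_pole f z"
  shows "isCont (rf_eval f) z"
  unfolding rf_eval_eq[abs_def] using assms by (intro continuous_intros) (auto simp: rf_pole_iff)

text \<open>Properness, too, can be read off from a fraction that is not in lowest terms, since
  cancelling a common factor lowers both degrees equally.\<close>

lemma rf_proper_iff:
  assumes f: "f = to_fract p / to_fract q" and q: "q \<noteq> 0"
  shows "rf_proper f \<longleftrightarrow> degree p \<le> degree q"
proof (cases "p = 0")
  case True
  then show ?thesis using rf_num_den_cross[OF f q] q by (simp add: rf_proper_def)
next
  case False
  have eq: "rf_num f * q = p * rf_den f" by (rule rf_num_den_cross[OF f q])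
  then have "rf_num f \<noteq> 0" using False by auto
  then have "degree (rf_num f) + degree q = degree p + degree (rf_den f)"
    using arg_cong[OF eq, of degree] False q by (simp add: degree_mult_eq)
  then show ?thesis by (auto simp: rf_proper_def)
qed

lemma
  assumes "rf_proper f" "rf_proper g"
  shows rf_proper_add: "rf_proper (f + g)" and rf_proper_mult: "rf_proper (f * g)"
proof -
  define a b c d where "a = rf_num f" and "b = rf_den f" and "c = rf_num g" and "d = rf_den g"
  note defs = a_def b_def c_def d_def
  have nz: "b \<noteq> 0" "d \<noteq> 0" by (simp_all add: defs)
  have f: "f = to_fract a / to_fract b" and g: "g = to_fract c / to_fract d"
    unfolding defs by (rule rf_num_den)+
  have add: "f + g = to_fract (a * d + c * b) / to_fract (b * d)"
    and mult: "f * g = to_fract (a * c) / to_fract (b * d)"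
    unfolding f g using nz by (simp_all add: field_simps)
  have le: "degree a \<le> degree b" "degree c \<le> degree d"
    using assms by (simp_all add: rf_proper_def defs)
  have bd: "b * d \<noteq> 0" "degree (b * d) = degree b + degree d"
    using nz by (simp_all add: degree_mult_eq)
  have "degree (a * d) \<le> degree (b * d)" "degree (c * b) \<le> degree (b * d)"
    "degree (a * c) \<le> degree (b * d)"
    unfolding bd using le degree_mult_le[of a d] degree_mult_le[of c b] degree_mult_le[of a c]
    by linarith+
  then show "rf_proper (f + g)" "rf_proper (f * g)"
    unfolding rf_proper_iff[OF add bd(1)] rf_proper_iff[OF mult bd(1)]
    by (auto intro: degree_add_le)
qed

lemma rf_proper_const [simp]: "rf_proper (rf_const c)"
  using rf_proper_iff[of "rf_const c" "[:c:]" 1] by (simp add: rf_const_def)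

lemma rf_proper_sum: "(\<And>i. i \<in> I \<Longrightarrow> rf_proper (f i)) \<Longrightarrow> rf_proper (sum f I)"
  using rf_proper_const[of 0]
  by (induction I rule: infinite_finite_induct) (auto intro: rf_proper_add)

text \<open>Needed to close the imaginary axis at infinity when the maximum modulus principle is applied
  in the right half plane.\<close>

lemma rf_proper_limit:
  assumes "rf_proper f"
  obtains l where "(rf_eval f \<longlongrightarrow> l) at_infinity"
proof -
  let ?p = "cpoly (rf_num f)" and ?q = "cpoly (rf_den f)"
  have le: "degree ?p \<le> degree ?q" using assms by (simp add: rf_proper_def)
  have "\<exists>l. ((\<lambda>z. poly ?p z / poly ?q z) \<longlongrightarrow> l) at_infinity"
  proof (cases "degree ?p < degree ?q")
    case True
    then show ?thesis using poly_divide_tendsto_0_at_infinity by blast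
  next
    case False
    then have deg: "degree ?q = degree ?p" using le by simp
    have "((\<lambda>z. (poly ?p z / z ^ degree ?p) / (poly ?q z / z ^ degree ?p))
        \<longlongrightarrow> lead_coeff ?p / lead_coeff ?q) at_infinity"
      using tendsto_divide[OF poly_divide_tendsto_aux[of ?p] poly_divide_tendsto_aux[of ?q]]
      unfolding deg[symmetric] by (simp del: degree_cpoly)
    moreover have "\<forall>\<^sub>F z in at_infinity.
        (poly ?p z / z ^ degree ?p) / (poly ?q z / z ^ degree ?p) = poly ?p z / poly ?q z"
      by (rule eventually_at_infinityI[of 1]) (auto simp: divide_simps)
    ultimately show ?thesis by (intro exI, rule Lim_transform_eventually)
  qed
  then show thesis using that by (auto simp: rf_eval_eq[abs_def])
qed

section \<open>Poles of a state-space realization\<close>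

text \<open>The system says \<open>(s I - a) p = b d\<close> with polynomial vectors. If \<open>d\<close> vanishes at \<open>z\<close>, then
  \<open>p\<close> evaluated at \<open>z\<close> lies in the kernel of \<open>z I - a\<close>; when \<open>z\<close> is not an eigenvalue this kernel is
  trivial, so the factor \<open>s - z\<close> divides every \<open>p i\<close> and can be cancelled. Repeating this exhausts the
  multiplicity of \<open>z\<close> in \<open>d\<close>.\<close>

lemma linear_system_dvd:
  fixes p :: "nat \<Rightarrow> complex poly" and d :: "complex poly"
  assumes eq: "\<And>i. i < n \<Longrightarrow> [:0, 1:] * p i - (\<Sum>l<n. [:a i l:] * p l) = [:b i:] * d"
    and dvd: "[:-z, 1:] ^ r dvd d"
    and noeig: "\<And>v i. (\<And>i. i < n \<Longrightarrow> (\<Sum>l<n. a i l * v l) = z * v i) \<Longrightarrow> i < n \<Longrightarrow> v i = 0"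
    and i: "i < n"
  shows "[:-z, 1:] ^ r dvd p i"
  using eq dvd i
proof (induction r arbitrary: p d i)
  case 0
  then show ?case by simp
next
  case (Suc r)
  let ?c = "[:-z, 1:]"
  obtain d' where d': "d = ?c * (?c ^ r * d')"
    using Suc.prems(2) unfolding power_Suc mult.assoc[symmetric] by (elim dvdE)
  have "poly (p j) z = 0" if "j < n" for j
  proof (rule noeig[OF _ that])
    fix k assume "k < n"
    from arg_cong[OF Suc.prems(1)[OF this], of "\<lambda>q. poly q z"]
    show "(\<Sum>l<n. a k l * poly (p l) z) = z * poly (p k) z"
      by (simp add: d' poly_sum)
  qed
  define p' where "p' j = p j div ?c" for j
  have p': "p j = ?c * p' j" if "j < n" for j
    using \<open>j < n \<Longrightarrow> poly (p j) z = 0\<close> that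
    by (metis poly_eq_0_iff_dvd dvd_mult_div_cancel p'_def)
  have "[:0, 1:] * p' k - (\<Sum>l<n. [:a k l:] * p' l) = [:b k:] * (?c ^ r * d')" if "k < n" for k
  proof -
    have "?c * ([:0, 1:] * p' k - (\<Sum>l<n. [:a k l:] * p' l))
        = [:0, 1:] * (?c * p' k) - (\<Sum>l<n. [:a k l:] * (?c * p' l))"
      by (simp only: right_diff_distrib sum_distrib_left mult.left_commute)
    also have "\<dots> = [:0, 1:] * p k - (\<Sum>l<n. [:a k l:] * p l)"
      using p' that by (simp del: mult_pCons_left mult_pCons_right)
    also have "\<dots> = ?c * ([:b k:] * (?c ^ r * d'))"
      by (subst Suc.prems(1)[OF that]) (simp only: d' mult.left_commute)
    finally show ?thesis by (subst (asm) mult_cancel_left) simp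
  qed
  then have "?c ^ r dvd p' i" using dvd_triv_left Suc.prems(3) by (rule Suc.IH)
  then show ?case using p'[OF Suc.prems(3)] by (simp del: mult_pCons_left mult_pCons_right)
qed

text \<open>Write the state response \<open>(s I - A)\<^sup>-\<^sup>1 B\<close> over a common denominator \<open>d\<close>. By
  \<open>linear_system_dvd\<close> all of the multiplicity of \<open>z\<close> in \<open>d\<close> cancels, so the state response is regular
  at \<open>z\<close>, and the output is a constant combination of the states. Working over the complex
  polynomials is essential: \<open>s - z\<close> need not be real.\<close>

lemma realization_no_pole:
  assumes real: "realization n A B C D H" and noeig: "\<not> state_eigenvalue n A z"
  shows "\<not> rf_pole (H $ p $ q) z"
proof -
  obtain X where
    X: "\<And>i q. i < n \<Longrightarrow> rf_s * X i q - (\<Sum>l<n. rf_const (A i l) * X l q) = rf_const (B i q)" and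
    H: "\<And>p q. H $ p $ q = (\<Sum>i<n. rf_const (C p i) * X i q) + rf_const (D $ p $ q)"
    using real unfolding realization_def by blast
  define d where "d = (\<Prod>l<n. rf_den (X l q))"
  define P where "P i = rf_num (X i q) * (\<Prod>l\<in>{..<n} - {i}. rf_den (X l q))" for i
  have d0: "d \<noteq> 0" by (simp add: d_def)
  have XP: "X i q = to_fract (P i) / to_fract d" if "i < n" for i
  proof -
    have "d = rf_den (X i q) * (\<Prod>l\<in>{..<n} - {i}. rf_den (X l q))"
      using that by (simp add: d_def prod.remove)
    moreover have "(\<Prod>l\<in>{..<n} - {i}. rf_den (X l q)) \<noteq> 0" by simp
    ultimately show ?thesis
      by (subst rf_num_den[of "X i q"]) (simp add: P_def)
  qed
  have sys: "[:0, 1:] * P i - (\<Sum>l<n. [:A i l:] * P l) = [:B i q:] * d" if "i < n" for i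
  proof -
    have dX: "to_fract d * X j q = to_fract (P j)" if "j < n" for j
      using d0 XP[OF that] by simp
    have "to_fract d * (rf_s * X i q - (\<Sum>l<n. rf_const (A i l) * X l q))
        = rf_s * (to_fract d * X i q) - (\<Sum>l<n. rf_const (A i l) * (to_fract d * X l q))"
      by (simp only: right_diff_distrib sum_distrib_left mult.left_commute)
    also have "\<dots> = rf_s * to_fract (P i) - (\<Sum>l<n. rf_const (A i l) * to_fract (P l))"
      using that dX by simp
    finally have "to_fract ([:0, 1:] * P i - (\<Sum>l<n. [:A i l:] * P l)) = to_fract ([:B i q:] * d)"
      using X[OF that, of q]
      by (simp only: to_fract_diff to_fract_mult to_fract_sum rf_s_def rf_const_def mult.commute)
    then show ?thesis by (simp only: to_fract_eq_iff)
  qed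
  have csys: "[:0, 1:] * cpoly (P i) - (\<Sum>l<n. [:of_real (A i l):] * cpoly (P l))
      = [:of_real (B i q):] * cpoly d" if "i < n" for i
    using arg_cong[OF sys[OF that], of cpoly] by simp
  let ?c = "[:-z, 1:]"
  define r where "r = order z (cpoly d)"
  have noeig': "v i = 0" if "\<And>i. i < n \<Longrightarrow> (\<Sum>l<n. of_real (A i l) * v l) = z * v i" "i < n" for v i
    using noeig that unfolding state_eigenvalue_def by blast
  have "\<not> rf_pole (X i q) z" if "i < n" for i
  proof
    assume pole: "rf_pole (X i q) z"
    obtain d' where d': "cpoly d = ?c ^ r * d'" "\<not> ?c dvd d'"
      using order_decomp[of "cpoly d" z] d0 by (auto simp: r_def)
    have "?c ^ r dvd cpoly (P i)"
      by (rule linear_system_dvd[where a = "\<lambda>i l. of_real (A i l)" and b = "\<lambda>i. of_real (B i q)"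
            and p = "\<lambda>i. cpoly (P i)" and d = "cpoly d" and n = n])
        (fact csys, use d'(1) in simp, fact noeig', fact that)
    then obtain P' where P': "cpoly (P i) = ?c ^ r * P'" by blast
    have "rf_num (X i q) * d = P i * rf_den (X i q)"
      using XP[OF that] d0 by (rule rf_num_den_cross)
    from arg_cong[OF this, of cpoly]
    have "?c ^ r * (cpoly (rf_num (X i q)) * d') = ?c ^ r * (P' * cpoly (rf_den (X i q)))"
      by (simp only: cpoly_mult d'(1) P' mult_ac)
    then have "cpoly (rf_num (X i q)) * d' = P' * cpoly (rf_den (X i q))"
      by (subst (asm) mult_cancel_left) simp
    from arg_cong[OF this, of "\<lambda>p. poly p z"]
    have "poly (cpoly (rf_num (X i q))) z * poly d' z = 0"
      using pole by (simp add: rf_pole_iff)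
    then show False
      using rf_num_nonzero_at_pole[OF pole] d'(2) by (simp add: poly_eq_0_iff_dvd)
  qed
  then show ?thesis unfolding H by (intro rf_pole_add rf_pole_sum rf_pole_mult) simp_all
qed

section \<open>Complex matrices and adjoints\<close>

lemma sum_UNIV_Plus:
  fixes f :: "'p::finite + 'q::finite \<Rightarrow> 'a::comm_monoid_add"
  shows "sum f UNIV = (\<Sum>a\<in>UNIV. f (Inl a)) + (\<Sum>b\<in>UNIV. f (Inr b))"
  unfolding UNIV_Plus_UNIV[symmetric] by (subst sum.Plus) auto

lemma vstack_nth [simp]:
  "vstack X Y $ Inl a = X $ a" "vstack X Y $ Inr b = Y $ b"
  by (simp_all add: vstack_def)

lemma vstack_mult: "vstack X Y ** Z = vstack (X ** Z) (Y ** Z)"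
  unfolding vec_eq_iff
proof (intro allI)
  fix i j show "(vstack X Y ** Z) $ i $ j = vstack (X ** Z) (Y ** Z) $ i $ j"
    by (cases i) (simp_all add: matrix_matrix_mult_def)
qed

lemma scale_mat_mult_left: "(c *\<^sub>m X) ** Y = (c::'a::comm_semiring_1) *\<^sub>m (X ** Y)"
  by (simp add: vec_eq_iff scale_mat_def matrix_matrix_mult_def sum_distrib_left mult.assoc)

lemma scale_mat_mult_right: "X ** (c *\<^sub>m Y) = (c::'a::comm_semiring_1) *\<^sub>m (X ** Y)"
  by (simp add: vec_eq_iff scale_mat_def matrix_matrix_mult_def sum_distrib_left mult.left_commute)

lemma scale_mat_1_mult_vec: "(complex_of_real c *\<^sub>m mat 1) *v v = c *\<^sub>R v"
proof -
  have "(complex_of_real c *\<^sub>m mat 1) *v v = of_real c *s (mat 1 *v v)"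
    by (simp add: vec_eq_iff scale_mat_def matrix_vector_mult_def sum_distrib_left mult.assoc)
  also have "\<dots> = c *\<^sub>R v" by (simp add: vec_eq_iff) (simp add: scaleR_conv_of_real)
  finally show ?thesis .
qed

lemma matrix_add_rdistrib: "(X + Y) ** Z = X ** Z + Y ** (Z::'a::semiring_1^'n^'m)"
  by (simp add: vec_eq_iff matrix_matrix_mult_def distrib_right sum.distrib)

lemma matrix_diff_rdistrib: "(X - Y) ** Z = X ** Z - Y ** (Z::'a::ring_1^'n^'m)"
  by (simp add: vec_eq_iff matrix_matrix_mult_def left_diff_distrib sum_subtractf)

lemma matrix_diff_ldistrib: "Z ** (X - Y) = Z ** X - Z ** (Y::'a::ring_1^'n^'m)"
  by (simp add: vec_eq_iff matrix_matrix_mult_def right_diff_distrib sum_subtractf)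

lemma scale_mat_0: "0 *\<^sub>m X = (0::'a::mult_zero^'n^'m)"
  by (simp add: vec_eq_iff scale_mat_def)

lemma scale_mat_diff: "c *\<^sub>m (X - Y) = c *\<^sub>m X - (c::'a::ring) *\<^sub>m Y"
  by (simp add: vec_eq_iff scale_mat_def right_diff_distrib)

lemma
  shows cmat_mult: "cmat (X ** Y) = cmat X ** cmat Y"
    and cmat_add: "cmat (X' + Y') = cmat X' + cmat Y'"
    and cmat_1: "cmat (mat 1) = mat 1"
  by (simp_all add: vec_eq_iff cmat_def matrix_matrix_mult_def mat_def)

lemma
  shows rmat_mult: "rmat (X ** Y) = rmat X ** rmat Y"
    and rmat_add: "rmat (X' + Y') = rmat X' + rmat Y'"
  by (simp_all add: vec_eq_iff rmat_def matrix_matrix_mult_def rf_const_add rf_const_mult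
      rf_const_sum)

lemma norm_cmat_mult_vec: "norm (cmat R *v (\<chi> i. complex_of_real (x $ i))) = norm (R *v x)"
proof -
  have "cmat R *v (\<chi> i. complex_of_real (x $ i)) = (\<chi> i. complex_of_real ((R *v x) $ i))"
    by (simp add: vec_eq_iff cmat_def matrix_vector_mult_def)
  then show ?thesis by (simp add: norm_vec_def)
qed

lemma norm_of_real_vec: "norm (\<chi> i. complex_of_real (x $ i)) = norm x"
  by (simp add: norm_vec_def)

definition adjoint_mat :: "complex^'n^'m \<Rightarrow> complex^'m^'n" where
  "adjoint_mat X = (\<chi> i j. cnj (X $ j $ i))"

lemma
  shows adjoint_mat_adjoint_mat [simp]: "adjoint_mat (adjoint_mat X) = X"
    and adjoint_mat_mult: "adjoint_mat (X ** Y) = adjoint_mat Y ** adjoint_mat X"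
    and adjoint_mat_diff: "adjoint_mat (X - X') = adjoint_mat X - adjoint_mat X'"
    and adjoint_mat_scale: "adjoint_mat (c *\<^sub>m X) = cnj c *\<^sub>m adjoint_mat X"
    and adjoint_mat_cmat: "adjoint_mat (cmat R) = cmat (transpose R)"
    and adjoint_mat_1: "adjoint_mat (mat 1) = mat 1"
  by (simp_all add: vec_eq_iff adjoint_mat_def matrix_matrix_mult_def mult.commute scale_mat_def
      cmat_def transpose_def mat_def)

lemma adjoint_mat_vstack_mult:
  "adjoint_mat (vstack P Q) ** vstack X Y = adjoint_mat P ** X + adjoint_mat Q ** Y"
  by (simp add: vec_eq_iff adjoint_mat_def matrix_matrix_mult_def sum_UNIV_Plus)

text \<open>The real inner product on complex vectors is the real part of the Hermitian one, which is all
  that norm estimates need; the adjoint with respect to it is the conjugate transpose.\<close>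

lemma inner_adjoint_mat:
  fixes u :: "complex^'m" and v :: "complex^'n"
  shows "u \<bullet> (X *v v) = (adjoint_mat X *v u) \<bullet> v"
proof -
  have inner_mult: "a \<bullet> (x * b) = (cnj x * a) \<bullet> b" for a x b :: complex
    by (simp add: inner_complex_def algebra_simps)
  have "u \<bullet> (X *v v) = (\<Sum>i\<in>UNIV. \<Sum>j\<in>UNIV. (cnj (X $ i $ j) * u $ i) \<bullet> v $ j)"
    by (simp add: inner_vec_def matrix_vector_mult_def inner_sum_right inner_mult)
  also have "\<dots> = (adjoint_mat X *v u) \<bullet> v"
    by (subst sum.swap) (simp add: inner_vec_def matrix_vector_mult_def inner_sum_left adjoint_mat_def)
  finally show ?thesis .
qed

lemma psd_inner:
  assumes "psd X"
  shows "0 \<le> v \<bullet> (X *v v)"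
proof -
  have "v \<bullet> (X *v v) = Re (\<Sum>i\<in>UNIV. cnj (v $ i) * (X *v v) $ i)"
    by (simp add: inner_vec_def inner_complex_def)
  then show ?thesis using assms by (simp add: psd_def)
qed

lemma matrix_inv_inverse:
  assumes "invertible X"
  shows "X ** matrix_inv X = mat 1" "matrix_inv X ** X = mat 1"
  using someI_ex[OF assms[unfolded invertible_def]] unfolding matrix_inv_def by blast+

lemma matrix_inverse_commute:
  fixes X Y :: "'a::field^'n^'n"
  shows "X ** Y = mat 1 \<Longrightarrow> Y ** X = mat 1"
  by (simp add: matrix_left_right_inverse)

text \<open>The quadratic form of the matrix at \<open>x\<close> is the sum of the squared norms of \<open>A\<^sup>T x\<close> and
  \<open>B\<^sup>T x\<close>, so a kernel vector is already in the kernel of \<open>A\<^sup>T\<close>.\<close>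

lemma invertible_gram:
  fixes A :: "real^'k^'k" and B :: "real^'m^'k"
  assumes A: "invertible A"
  shows "invertible (A ** transpose A + B ** transpose B)"
proof -
  let ?G = "A ** transpose A + B ** transpose B"
  have "x = 0" if "?G *v x = 0" for x
  proof -
    have "x \<bullet> (?G *v x) = (norm (transpose A *v x))\<^sup>2 + (norm (transpose B *v x))\<^sup>2"
      by (simp add: matrix_vector_mult_add_rdistrib inner_add_right power2_norm_eq_inner
          dot_lmul_matrix transpose_matrix_vector flip: matrix_vector_mul_assoc)
    then have "transpose A *v x = 0"
      using that by (simp add: add_nonneg_eq_0_iff)
    moreover have "invertible (transpose A)" using A by (rule transpose_invertible)
    ultimately show "x = 0"
      by (metis matrix_inv_inverse(2) matrix_vector_mul_assoc matrix_vector_mul_lid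
          matrix_vector_mult_0_right)
  qed
  then show ?thesis by (metis invertible_left_inverse matrix_left_invertible_ker)
qed

section \<open>Gain bounds at a single frequency\<close>

text \<open>Since \<open>S = D\<^sup>-\<^sup>1\<close>, the Gram matrix of \<open>L S\<close> is the inverse of \<open>D G\<^sup>-\<^sup>1 D\<^sup>*\<close>, and inverting
  reverses a bound from below by \<open>c I\<close>. The proof makes this inversion explicit: for \<open>w = S v\<close> it
  tests the lower bound on the vector \<open>y = D\<^sup>-\<^sup>* G w\<close>, for which \<open>D G\<^sup>-\<^sup>1 D\<^sup>* y = v\<close>.\<close>

lemma gain_upper_bound:
  fixes L :: "complex^'k^'p" and D S :: "complex^'k^'k"
  assumes gram: "adjoint_mat L ** L = G" and inv: "G ** Gi = mat 1"
    and DS: "D ** S = mat 1" and c: "c > 0"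
    and coercive: "\<And>y. c * (norm y)\<^sup>2 \<le> y \<bullet> ((D ** Gi ** adjoint_mat D) *v y)"
  shows "(norm ((L ** S) *v v))\<^sup>2 \<le> (norm v)\<^sup>2 / c"
proof -
  define w where "w = S *v v"
  define y where "y = adjoint_mat S *v (G *v w)"
  have Dw: "D *v w = v" by (simp add: w_def matrix_vector_mul_assoc DS)
  have "adjoint_mat D ** adjoint_mat S = mat 1"
    using matrix_inverse_commute[OF DS] by (metis adjoint_mat_mult adjoint_mat_1)
  then have Dy: "adjoint_mat D *v y = G *v w"
    by (simp add: y_def matrix_vector_mul_assoc matrix_mul_assoc)
  have "(norm (L *v w))\<^sup>2 = (G *v w) \<bullet> w"
    by (simp add: power2_norm_eq_inner inner_adjoint_mat gram matrix_vector_mul_assoc)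
  also have "\<dots> = y \<bullet> (D *v w)" by (simp add: inner_adjoint_mat Dy)
  finally have q: "(norm (L *v w))\<^sup>2 = y \<bullet> v" by (simp add: Dw)
  have "(D ** Gi ** adjoint_mat D) *v y = D *v (Gi *v (adjoint_mat D *v y))"
    by (simp add: matrix_vector_mul_assoc matrix_mul_assoc)
  also have "\<dots> = D *v w"
    using matrix_inverse_commute[OF inv] by (simp add: Dy matrix_vector_mul_assoc)
  finally have "c * (norm y)\<^sup>2 \<le> y \<bullet> v" using coercive[of y] by (simp add: Dw)
  moreover have yv: "y \<bullet> v \<le> norm y * norm v" by (rule norm_cauchy_schwarz)
  ultimately have "norm y * (c * norm y) \<le> norm y * norm v"
    by (simp add: power2_eq_square mult.left_commute)
  then have "c * norm y \<le> norm v"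
    by (cases "y = 0") simp_all
  then have "c * (y \<bullet> v) \<le> norm v * norm v"
    using yv c by (smt (verit) mult.assoc mult_left_mono mult_right_mono norm_ge_zero)
  then show ?thesis
    using c q by (simp add: w_def matrix_vector_mul_assoc field_simps power2_eq_square)
qed

text \<open>Among all \<open>T\<close> with \<open>L\<^sup>* T = - I\<close>, the matrix \<open>- L G\<^sup>-\<^sup>1\<close> has the least norm at every vector:
  the columns of \<open>L\<close> are orthogonal to the difference of any two solutions. Its Gram matrix is
  \<open>G\<^sup>-\<^sup>1\<close>, so its squared norm is the norm of \<open>G\<^sup>-\<^sup>1\<close>.\<close>

lemma gain_lower_bound:
  fixes L T :: "complex^'k^'p"
  assumes gram: "adjoint_mat L ** L = G" and inv: "G ** Gi = mat 1" and sym: "adjoint_mat Gi = Gi"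
    and T: "adjoint_mat L ** T = - mat 1" and h: "\<And>v. norm (T *v v) \<le> h * norm v"
  shows "norm (Gi *v x) \<le> h\<^sup>2 * norm x"
proof -
  define R where "R = L ** Gi"
  have RR: "(R *v y) \<bullet> (R *v x) = (Gi *v y) \<bullet> x" for x y
  proof -
    have "adjoint_mat R ** R = Gi ** (adjoint_mat L ** L) ** Gi"
      by (simp add: R_def adjoint_mat_mult sym matrix_mul_assoc)
    also have "\<dots> = Gi"
      using inv by (simp add: gram flip: matrix_mul_assoc)
    finally show ?thesis by (simp add: inner_adjoint_mat matrix_vector_mul_assoc)
  qed
  \<comment> \<open>\<open>- R x\<close> is the orthogonal projection of \<open>T x\<close> onto the range of \<open>L\<close>.\<close>
  have bound: "norm (R *v x) \<le> h * norm x" for x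
  proof -
    have "(R *v x) \<bullet> (T *v x) = (Gi *v x) \<bullet> ((adjoint_mat L ** T) *v x)"
      using inner_adjoint_mat[of "Gi *v x" "adjoint_mat L" "T *v x"]
      by (simp add: R_def matrix_vector_mul_assoc)
    also have "\<dots> = - ((norm (R *v x))\<^sup>2)"
      using matrix_vector_mult_diff_rdistrib[of 0 "mat 1" x]
      by (simp add: T power2_norm_eq_inner RR)
    finally have "norm (R *v x) * norm (R *v x) \<le> norm (R *v x) * norm (T *v x)"
      using Cauchy_Schwarz_ineq2[of "R *v x" "T *v x"] by (simp add: power2_eq_square)
    then have "norm (R *v x) \<le> norm (T *v x)"
      by (cases "R *v x = 0") simp_all
    then show ?thesis using h[of x] by linarith
  qed
  have "(norm (Gi *v x))\<^sup>2 = (Gi *v (Gi *v x)) \<bullet> x"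
    by (simp add: power2_norm_eq_inner inner_adjoint_mat sym)
  also have "\<dots> = (R *v (Gi *v x)) \<bullet> (R *v x)" by (simp add: RR)
  also have "\<dots> \<le> norm (R *v (Gi *v x)) * norm (R *v x)" by (rule norm_cauchy_schwarz)
  also have "\<dots> \<le> (h * norm (Gi *v x)) * (h * norm x)"
    using bound norm_ge_zero order_trans by (intro mult_mono) blast+
  finally have "norm (Gi *v x) * norm (Gi *v x) \<le> norm (Gi *v x) * (h\<^sup>2 * norm x)"
    by (simp add: power2_eq_square mult_ac)
  then show ?thesis by (cases "Gi *v x = 0") simp_all
qed

section \<open>Values of transfer matrices\<close>

text \<open>Evaluation is a homomorphism only at points that are not poles of any entry, because the
  value at a pole is a conventional zero.\<close>

definition regular_at :: "ratfun^'n^'m \<Rightarrow> complex \<Rightarrow> bool" where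
  "regular_at H z \<longleftrightarrow> (\<forall>i j. \<not> rf_pole (H $ i $ j) z)"

lemma
  assumes "regular_at X z" "regular_at Y z"
  shows regular_at_mult: "regular_at (X ** Y) z"
    and eval_mat_mult: "eval_mat (X ** Y) z = eval_mat X z ** eval_mat Y z"
  using assms
  by (auto simp: regular_at_def eval_mat_def matrix_matrix_mult_def vec_eq_iff
      rf_eval_sum rf_pole_mult rf_eval_mult intro!: rf_pole_sum)

lemma
  assumes "regular_at X z" "regular_at Y z"
  shows regular_at_diff: "regular_at (X - Y) z"
    and eval_mat_diff: "eval_mat (X - Y) z = eval_mat X z - eval_mat Y z"
  using assms by (auto simp: regular_at_def eval_mat_def vec_eq_iff rf_pole_diff rf_eval_diff)

lemma
  shows regular_at_rmat [simp]: "regular_at (rmat R) z"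
    and eval_mat_rmat [simp]: "eval_mat (rmat R) z = cmat R"
  by (simp_all add: regular_at_def eval_mat_def rmat_def cmat_def)

lemma
  shows regular_at_pencil: "regular_at (rf_s *\<^sub>m rmat E - rmat A) z"
    and eval_mat_pencil: "eval_mat (rf_s *\<^sub>m rmat E - rmat A) z = z *\<^sub>m cmat E - cmat A"
  by (simp_all add: regular_at_def eval_mat_def rmat_def cmat_def scale_mat_def vec_eq_iff
      rf_pole_diff rf_pole_mult rf_eval_diff rf_eval_mult)

lemma rmat_1: "rmat (mat 1) = mat 1"
  by (simp add: vec_eq_iff rmat_def mat_def)

lemma eval_mat_1: "eval_mat (mat 1) z = mat 1"
  by (metis eval_mat_rmat rmat_1 cmat_1)

lemma eval_mat_vstack: "eval_mat (vstack X Y) z = vstack (eval_mat X z) (eval_mat Y z)"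
  unfolding vec_eq_iff
proof (intro allI)
  fix i j show "eval_mat (vstack X Y) z $ i $ j = vstack (eval_mat X z) (eval_mat Y z) $ i $ j"
    by (cases i) (simp_all add: eval_mat_def)
qed

lemma regular_at_vstack: "regular_at (vstack X Y) z \<longleftrightarrow> regular_at X z \<and> regular_at Y z"
  by (simp add: regular_at_def split_sum_all)

lemma RH_inf_iff: "H \<in> RH_inf \<longleftrightarrow> proper_mat H \<and> (\<forall>z. Re z \<ge> 0 \<longrightarrow> regular_at H z)"
  unfolding RH_inf_def regular_at_def by (auto simp: not_le[symmetric])

lemma RL_inf_regular_at: "H \<in> RL_inf \<Longrightarrow> Re z = 0 \<Longrightarrow> regular_at H z"
  by (auto simp: RL_inf_def regular_at_def)

lemma RH_inf_mult: "X \<in> RH_inf \<Longrightarrow> Y \<in> RH_inf \<Longrightarrow> X ** Y \<in> RH_inf"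
  by (auto simp: RH_inf_iff regular_at_mult)
    (auto simp: proper_mat_def matrix_matrix_mult_def intro!: rf_proper_sum rf_proper_mult)

lemma RH_inf_vstack: "X \<in> RH_inf \<Longrightarrow> Y \<in> RH_inf \<Longrightarrow> vstack X Y \<in> RH_inf"
  by (auto simp: RH_inf_iff regular_at_vstack proper_mat_def split_sum_all)

lemma rmat_RH_inf: "rmat R \<in> RH_inf"
  by (simp add: RH_inf_iff proper_mat_def) (simp add: rmat_def)

section \<open>Gain in the right half plane\<close>

text \<open>The maximum modulus principle on the half discs \<open>Re w > 0\<close>, \<open>|w| < \<rho>\<close>. The limit at infinity
  is also the limit along the imaginary axis, so it is bounded by \<open>b\<close>, and on
  large arcs \<open>f\<close> exceeds \<open>b\<close> by at most \<open>e\<close>.\<close>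

lemma half_plane_maximum_modulus:
  assumes holo: "f holomorphic_on {z. Re z > 0}" and cont: "continuous_on {z. Re z \<ge> 0} f"
    and lim: "(f \<longlongrightarrow> l) at_infinity"
    and axis: "\<And>\<omega>. norm (f (\<i> * complex_of_real \<omega>)) \<le> b"
    and z: "Re z > 0"
  shows "norm (f z) \<le> b"
proof (rule field_le_epsilon)
  fix e :: real assume e: "e > 0"
  have "filterlim (\<lambda>n::nat. \<i> * complex_of_real (real n)) at_infinity sequentially"
    unfolding filterlim_at_infinity_conv_norm_at_top
    by (simp add: norm_mult filterlim_real_sequentially)
  then have "(\<lambda>n::nat. f (\<i> * complex_of_real (real n))) \<longlonglongrightarrow> l"
    by (rule filterlim_compose[OF lim])
  from tendsto_norm[OF this] have "norm l \<le> b"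
    by (rule Lim_bounded[where M = 0]) (use axis in blast)
  from e lim obtain r where r: "\<And>w. norm w \<ge> r \<Longrightarrow> dist (f w) l < e"
    unfolding tendsto_iff eventually_at_infinity by meson
  have far: "norm (f w) \<le> b + e" if "norm w \<ge> r" for w
    using r[OF that] \<open>norm l \<le> b\<close> norm_triangle_sub[of "f w" l] by (simp add: dist_norm)
  define \<rho> where "\<rho> = max r (norm z + 1)"
  define S where "S = {w. Re w > 0} \<inter> ball 0 \<rho>"
  have op: "open S" unfolding S_def by (intro open_Int open_halfspace_Re_gt open_ball)
  have "closed ({w. Re w \<ge> 0} \<inter> cball (0::complex) \<rho>)"
    by (intro closed_Int closed_halfspace_Re_ge closed_cball)
  then have cl: "closure S \<subseteq> {w. Re w \<ge> 0} \<inter> cball 0 \<rho>"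
    unfolding S_def by (intro closure_minimal) auto
  show "norm (f z) \<le> b + e"
  proof (rule maximum_modulus_frontier[of f S])
    show "f holomorphic_on interior S"
      using holo by (rule holomorphic_on_subset) (use interior_subset[of S] S_def in blast)
    show "continuous_on (closure S) f" using cont by (rule continuous_on_subset) (use cl in blast)
    show "bounded S" unfolding S_def by (simp add: bounded_Int)
    show "z \<in> S" using z by (simp add: S_def \<rho>_def)
    fix w assume "w \<in> frontier S"
    then have w: "w \<in> closure S" "w \<notin> S" using op by (auto simp: frontier_def interior_open)
    with cl have "Re w \<ge> 0" "norm w \<le> \<rho>" by auto
    with w(2) consider "Re w = 0" | "norm w = \<rho>" by (force simp: S_def)
    then show "norm (f w) \<le> b + e"
    proof cases
      case 1
      then have "w = \<i> * complex_of_real (Im w)" by (simp add: complex_eq_iff)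
      then show ?thesis using axis[of "Im w"] e by simp
    next
      case 2
      then show ?thesis by (intro far) (simp add: \<rho>_def)
    qed
  qed
qed

lemma norm_cnj_sum_le:
  fixes a b :: "complex^'p"
  shows "norm (\<Sum>i\<in>UNIV. cnj (a $ i) * b $ i) \<le> norm a * norm b"
proof -
  have "norm (\<Sum>i\<in>UNIV. cnj (a $ i) * b $ i) \<le> (\<Sum>i\<in>UNIV. norm (a $ i) * norm (b $ i))"
    by (rule order_trans[OF norm_sum]) (simp add: norm_mult)
  also have "\<dots> \<le> norm a * norm b"
    unfolding norm_vec_def using L2_set_mult_ineq[of "\<lambda>i. norm (a $ i)" "\<lambda>i. norm (b $ i)" UNIV]
    by simp
  finally show ?thesis .
qed

lemma rf_eval_at_infinity_vec:
  fixes H :: "ratfun^'n^'p"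
  assumes "proper_mat H"
  shows "\<exists>l. ((\<lambda>z. \<Sum>i\<in>UNIV. a i * (eval_mat H z *v v) $ i) \<longlongrightarrow> l) at_infinity"
proof -
  have "\<forall>i j. \<exists>l. (rf_eval (H $ i $ j) \<longlongrightarrow> l) at_infinity"
    using assms rf_proper_limit unfolding proper_mat_def by metis
  then obtain l where l: "\<And>i j. (rf_eval (H $ i $ j) \<longlongrightarrow> l i j) at_infinity" by metis
  have "((\<lambda>z. \<Sum>i\<in>UNIV. a i * (\<Sum>j\<in>UNIV. rf_eval (H $ i $ j) z * v $ j))
      \<longlongrightarrow> (\<Sum>i\<in>UNIV. a i * (\<Sum>j\<in>UNIV. l i j * v $ j))) at_infinity"
    by (intro tendsto_intros l)
  then show ?thesis by (auto simp: eval_mat_def matrix_vector_mult_def)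
qed

text \<open>The scalar principle is applied to the pairing of \<open>H w v\<close>, as a function of \<open>w\<close>, with the fixed
  vector \<open>a = H z v\<close>, which turns the norm at \<open>z\<close> into the value of a holomorphic function.\<close>

lemma RH_inf_gain_bound:
  fixes H :: "ratfun^'n^'p"
  assumes H: "H \<in> RH_inf"
    and axis: "\<And>\<omega>. norm (eval_mat H (\<i> * complex_of_real \<omega>) *v v) \<le> b"
    and z: "Re z > 0"
  shows "norm (eval_mat H z *v v) \<le> b"
proof -
  define a where "a = eval_mat H z *v v"
  define f where "f w = (\<Sum>i\<in>UNIV. cnj (a $ i) * (eval_mat H w *v v) $ i)" for w
  have f_eq: "f = (\<lambda>w. \<Sum>i\<in>UNIV. cnj (a $ i) * (\<Sum>j\<in>UNIV. rf_eval (H $ i $ j) w * v $ j))"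
    by (simp add: f_def eval_mat_def matrix_vector_mult_def fun_eq_iff)
  have reg: "\<not> rf_pole (H $ i $ j) w" if "Re w \<ge> 0" for i j w
    using H that by (simp add: RH_inf_iff regular_at_def)
  obtain l where lim: "(f \<longlongrightarrow> l) at_infinity"
    using rf_eval_at_infinity_vec[of H "\<lambda>i. cnj (a $ i)" v] H
    by (auto simp: RH_inf_iff f_def[abs_def])
  have "norm (f z) \<le> norm a * b"
  proof (rule half_plane_maximum_modulus[OF _ _ lim _ z])
    show "f holomorphic_on {w. Re w > 0}"
      unfolding f_eq by (intro holomorphic_intros rf_eval_holomorphic) (simp add: reg)
    show "continuous_on {w. Re w \<ge> 0} f"
      unfolding f_eq
      by (intro continuous_intros holomorphic_on_imp_continuous_on rf_eval_holomorphic)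
        (simp add: reg)
    show "norm (f (\<i> * complex_of_real \<omega>)) \<le> norm a * b" for \<omega>
      unfolding f_def by (rule order_trans[OF norm_cnj_sum_le mult_left_mono[OF axis norm_ge_zero]])
  qed
  moreover have "f z = complex_of_real ((norm a)\<^sup>2)"
    by (simp add: f_def a_def[symmetric] norm_vec_def L2_set_def sum_nonneg
        mult.commute flip: complex_norm_square)
  ultimately have "norm a * norm a \<le> norm a * b"
    by (simp add: power2_eq_square norm_mult)
  moreover have "0 \<le> b" using axis[of 0] norm_ge_zero order_trans by blast
  ultimately show ?thesis by (cases "a = 0") (simp_all add: a_def)
qed

lemma norm_mult_vec_le_spectral_norm:
  "norm (X *v v) \<le> spectral_norm X * norm v" for X :: "complex^'n^'p"
  unfolding spectral_norm_def by (intro onorm matrix_vector_mul_bounded_linear)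

text \<open>The supremum runs over the open half plane only; points of the imaginary axis that are not
  poles are reached by continuity.\<close>

lemma Hinf_norm_bound:
  fixes H :: "ratfun^'n^'p"
  assumes H: "Hinf_norm H \<le> ereal h" and reg: "regular_at H z" and z: "Re z \<ge> 0"
  shows "norm (eval_mat H z *v v) \<le> h * norm v"
proof -
  define w where "w n = z + complex_of_real (inverse (real (Suc n)))" for n
  have "(\<lambda>n. z + complex_of_real (inverse (real (Suc n)))) \<longlonglongrightarrow> z + complex_of_real 0"
    by (intro tendsto_intros LIMSEQ_inverse_real_of_nat)
  then have w: "w \<longlonglongrightarrow> z" by (simp add: w_def[abs_def])
  have bound: "norm (eval_mat H (w n) *v v) \<le> h * norm v" for n
  proof -
    have "Re (w n) > 0" using z by (simp add: w_def add_nonneg_pos)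
    then have "ereal (spectral_norm (eval_mat H (w n))) \<le> Hinf_norm H"
      unfolding Hinf_norm_def by (intro SUP_upper) simp
    with H have "ereal (spectral_norm (eval_mat H (w n))) \<le> ereal h" by (rule order_trans[rotated])
    then have "spectral_norm (eval_mat H (w n)) * norm v \<le> h * norm v"
      by (simp add: mult_right_mono)
    with norm_mult_vec_le_spectral_norm show ?thesis by (rule order_trans)
  qed
  have "(\<lambda>n. rf_eval (H $ i $ j) (w n)) \<longlonglongrightarrow> rf_eval (H $ i $ j) z" for i j
    using rf_eval_isCont reg w unfolding regular_at_def by (metis isCont_tendsto_compose)
  then have "(\<lambda>n. eval_mat H (w n) *v v) \<longlonglongrightarrow> eval_mat H z *v v"
    unfolding matrix_vector_mult_def eval_mat_def by (intro tendsto_intros) simp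
  then have "(\<lambda>n. norm (eval_mat H (w n) *v v)) \<longlonglongrightarrow> norm (eval_mat H z *v v)"
    by (rule tendsto_norm)
  then show ?thesis by (rule Lim_bounded) (use bound in blast)
qed

section \<open>The optimal controller\<close>

text \<open>The bridge from the eigenvalue condition on a state matrix to the absence of poles in the
  closed right half plane.\<close>

lemma minimal_realization_hurwitz_RH_inf:
  assumes "minimal_realization_hurwitz E A"
  defines "P \<equiv> rf_s *\<^sub>m rmat E - rmat A"
  shows "invertible P" "matrix_inv P \<in> RH_inf"
proof -
  obtain n A' B' C' D' where P: "invertible P" "proper_mat (matrix_inv P)"
    and real: "realization n A' B' C' D' (matrix_inv P)"
    and hurwitz: "\<And>z. state_eigenvalue n A' z \<Longrightarrow> Re z < 0"
    using assms(1) unfolding minimal_realization_hurwitz_def minimal_realization_def Let_def P_def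
    by blast
  have "regular_at (matrix_inv P) z" if "Re z \<ge> 0" for z
    unfolding regular_at_def using realization_no_pole[OF real] hurwitz that by (meson not_le)
  then show "invertible P" "matrix_inv P \<in> RH_inf" using P by (simp_all add: RH_inf_iff)
qed

lemma closed_loop_eq:
  "closed_loop M N K = vstack (matrix_inv (M - N ** K)) (K ** matrix_inv (M - N ** K))"
  by (simp add: closed_loop_def vstack_mult)

text \<open>Both the upper and the lower bound see the closed loop only through its values at points
  where nothing has a pole; the identity \<open>(M - N K) Y = I\<close> can be evaluated there.\<close>

lemma closed_loop_value:
  assumes Y: "matrix_inv (M - N ** K) = Y" and inv: "invertible (M - N ** K)"
    and reg: "regular_at M z" "regular_at N z" "regular_at K z" "regular_at Y z"
  shows "regular_at (closed_loop M N K) z"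
    and "eval_mat (closed_loop M N K) z = vstack (eval_mat Y z) (eval_mat K z ** eval_mat Y z)"
    and "(eval_mat M z - eval_mat N z ** eval_mat K z) ** eval_mat Y z = mat 1"
proof -
  show "regular_at (closed_loop M N K) z"
    by (simp add: closed_loop_eq regular_at_vstack regular_at_mult Y reg)
  show "eval_mat (closed_loop M N K) z = vstack (eval_mat Y z) (eval_mat K z ** eval_mat Y z)"
    by (simp add: closed_loop_eq eval_mat_vstack eval_mat_mult Y reg)
  have "eval_mat ((M - N ** K) ** Y) z = mat 1"
    using matrix_inv_inverse(1)[OF inv] by (simp add: Y eval_mat_1)
  then show "(eval_mat M z - eval_mat N z ** eval_mat K z) ** eval_mat Y z = mat 1"
    by (simp add: eval_mat_mult eval_mat_diff regular_at_mult regular_at_diff reg)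
qed

theorem corollary1:
  fixes E A :: "real^'k^'k" and B :: "real^'m^'k"
    and K :: "real^'k^'m" and F G :: "real^'k^'k"
    and M :: "ratfun^'k^'k" and N :: "ratfun^'m^'k"
  assumes M: "M = rf_s *\<^sub>m rmat E - rmat A"
    and N: "N = rmat B"
    and A: "invertible A"
    and realizable: "realizable M N"
    and nonsingular: "\<And>\<omega>::real. invertible ((\<i> * complex_of_real \<omega>) *\<^sub>m cmat E - cmat A)"
    and K: "K = transpose B ** transpose (matrix_inv A)"
    and F: "F = E ** transpose A"
    and G: "G = A ** transpose A + B ** transpose B"
    and hurwitz: "minimal_realization_hurwitz E
                    (A + B ** transpose B ** transpose (matrix_inv A))"
    and ineq: "\<And>\<omega>::real.
           complex_of_real (\<omega>\<^sup>2) *\<^sub>m cmat (F ** matrix_inv G ** transpose F)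
             + (\<i> * complex_of_real \<omega>) *\<^sub>m cmat (transpose F - F) + cmat G
           \<succeq> complex_of_real (inverse (spectral_norm (matrix_inv G))) *\<^sub>m mat 1"
  shows "solves_Hinf_problem M N (rmat K)"
proof -
  define \<gamma> where "\<gamma> = spectral_norm (matrix_inv G)"
  define Gi where "Gi = cmat (matrix_inv G)"
  define L where "L = vstack (cmat (transpose A)) (cmat (transpose B))"
  define At where "At = A + B ** transpose B ** transpose (matrix_inv A)"
  define X where "X = matrix_inv (M - N ** rmat K)"

  have invG: "G ** matrix_inv G = mat 1" "matrix_inv G ** G = mat 1"
    using matrix_inv_inverse[OF invertible_gram[OF A, of B]] by (simp_all add: G)
  have GGi: "cmat G ** Gi = mat 1"
    by (simp add: Gi_def invG cmat_1 flip: cmat_mult)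
  have "transpose G = G" by (simp add: G transpose_def matrix_matrix_mult_def vec_eq_iff mult.commute)
  then have "transpose (matrix_inv G) ** G = mat 1"
    using arg_cong[OF invG(1), of transpose] by (simp add: matrix_transpose_mul)
  then have "transpose (matrix_inv G) = matrix_inv G"
    by (metis invG(1) matrix_mul_assoc matrix_mul_lid matrix_mul_rid)
  then have Gi_sym: "adjoint_mat Gi = Gi" by (simp add: Gi_def adjoint_mat_cmat)
  have adjL: "adjoint_mat L ** vstack Y Z = cmat A ** Y + cmat B ** Z"
    for Y Z :: "complex^'n^_"
    by (simp add: L_def adjoint_mat_vstack_mult adjoint_mat_cmat)
  have gram: "adjoint_mat L ** L = cmat G"
    by (subst (2) L_def) (simp add: adjL G cmat_add cmat_mult)
  have \<gamma>: "\<gamma> > 0"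
  proof (rule ccontr)
    assume "\<not> \<gamma> > 0"
    moreover have "norm (matrix_inv G *v 1) \<le> \<gamma> * norm (1 :: real^'k)"
      unfolding \<gamma>_def spectral_norm_def by (intro onorm matrix_vector_mul_bounded_linear)
    ultimately have "norm (matrix_inv G *v 1) \<le> 0"
      using order_trans mult_nonpos_nonneg norm_ge_zero not_less by metis
    then have "G *v (matrix_inv G *v 1) = 0" by simp
    then have "(1 :: real^'k) = 0" by (simp only: matrix_vector_mul_assoc invG matrix_vector_mul_lid)
    then show False by simp
  qed

  have AtA: "transpose (matrix_inv A) ** transpose A = mat 1"
    "transpose A ** transpose (matrix_inv A) = mat 1"
    using matrix_inv_inverse[OF A] by (simp_all flip: matrix_transpose_mul)
  have pencil: "M - N ** rmat K = rf_s *\<^sub>m rmat E - rmat At"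
    by (simp add: M N K At_def rmat_add matrix_mul_assoc flip: rmat_mult)
  have inv: "invertible (M - N ** rmat K)" and X: "X \<in> RH_inf"
    using minimal_realization_hurwitz_RH_inf[OF hurwitz] by (simp_all add: pencil X_def At_def)
  have regX: "regular_at X z" if "Re z \<ge> 0" for z using X that by (simp add: RH_inf_iff)
  have regMN: "regular_at M z" "regular_at N z" for z by (simp_all add: M N regular_at_pencil)
  have feasible: "rmat K \<in> feasible M N"
    using inv X by (simp add: feasible_def stabilizing_def X_def RL_inf_def proper_mat_def)
      (simp add: rmat_def)

  have upper: "Hinf_norm (closed_loop M N (rmat K)) \<le> ereal (sqrt \<gamma>)"
  proof -
    have axis: "norm (eval_mat (closed_loop M N (rmat K)) (\<i> * complex_of_real \<omega>) *v v)
        \<le> sqrt \<gamma> * norm v" for \<omega> v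
    proof -
      let ?z = "\<i> * complex_of_real \<omega>"
      define D where "D = ?z *\<^sub>m cmat F - cmat G"
      \<comment> \<open>\<open>S\<close> is \<open>D\<^sup>-\<^sup>1\<close>: since \<open>M - N K = D A\<^sup>-\<^sup>T\<close> at \<open>?z\<close>, the inverse is \<open>A\<^sup>-\<^sup>T\<close> times the value of \<open>X\<close>.\<close>
      define S where "S = cmat (transpose (matrix_inv A)) ** eval_mat X ?z"
      define Xz where "Xz = eval_mat X ?z"
      have regX: "regular_at X ?z" by (rule regX) simp
      note val = closed_loop_value(2-3)[OF X_def[symmetric] inv regMN regular_at_rmat regX,
          folded Xz_def]
      have PX: "(?z *\<^sub>m cmat E - cmat A - cmat B ** cmat K) ** Xz = mat 1"
        using val(2) by (simp add: M N eval_mat_pencil)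
      have LS: "L ** S = eval_mat (closed_loop M N (rmat K)) ?z"
        unfolding val(1) eval_mat_rmat
        by (simp add: L_def S_def vstack_mult matrix_mul_assoc K AtA cmat_1 flip: cmat_mult Xz_def)
      have "F ** transpose (matrix_inv A) = E"
        by (simp add: F AtA flip: matrix_mul_assoc)
      moreover have "G ** transpose (matrix_inv A) = A + B ** K"
        by (simp add: G K AtA matrix_add_rdistrib flip: matrix_mul_assoc)
      ultimately have "D ** cmat (transpose (matrix_inv A)) = ?z *\<^sub>m cmat E - cmat A - cmat B ** cmat K"
        by (simp add: D_def matrix_diff_rdistrib scale_mat_mult_left cmat_add flip: cmat_mult)
      then have DS: "D ** S = mat 1" by (simp add: S_def matrix_mul_assoc PX flip: Xz_def)

      have DGi: "D ** Gi = ?z *\<^sub>m (cmat F ** Gi) - mat 1"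
        by (simp add: D_def matrix_diff_rdistrib scale_mat_mult_left GGi)
      have adjD: "adjoint_mat D = (- ?z) *\<^sub>m cmat (transpose F) - cmat G"
        by (simp add: D_def adjoint_mat_diff adjoint_mat_scale adjoint_mat_cmat \<open>transpose G = G\<close>)
      \<comment> \<open>On the imaginary axis the conjugate of \<open>?z\<close> is \<open>- ?z\<close> and \<open>- ?z * ?z = \<omega>\<^sup>2\<close>, so this product is
          the left-hand side of the assumed inequality.\<close>
      have "D ** Gi ** adjoint_mat D
          = (- ?z) *\<^sub>m (?z *\<^sub>m cmat (F ** matrix_inv G ** transpose F)) - ?z *\<^sub>m cmat F
            - ((- ?z) *\<^sub>m cmat (transpose F) - cmat G)"
        unfolding DGi adjD
        by (simp add: matrix_diff_rdistrib matrix_diff_ldistrib scale_mat_mult_left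
            scale_mat_mult_right scale_mat_diff Gi_def invG flip: cmat_mult matrix_mul_assoc)
      also have "\<dots> = complex_of_real (\<omega>\<^sup>2) *\<^sub>m cmat (F ** matrix_inv G ** transpose F)
             + ?z *\<^sub>m cmat (transpose F - F) + cmat G"
        by (simp add: vec_eq_iff scale_mat_def cmat_def power2_eq_square algebra_simps)
      finally have DGD: "D ** Gi ** adjoint_mat D = \<dots>" .
      have coercive: "inverse \<gamma> * (norm y)\<^sup>2 \<le> y \<bullet> ((D ** Gi ** adjoint_mat D) *v y)" for y
        using psd_inner[OF ineq[of \<omega>, unfolded loewner_ge_def, folded DGD \<gamma>_def], of y]
        by (simp add: matrix_vector_mult_diff_rdistrib scale_mat_1_mult_vec inner_diff_right
            power2_norm_eq_inner del: of_real_inverse)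
      have "(norm (eval_mat (closed_loop M N (rmat K)) ?z *v v))\<^sup>2 \<le> (norm v)\<^sup>2 / inverse \<gamma>"
        unfolding LS[symmetric]
        by (rule gain_upper_bound[OF gram GGi DS _ coercive]) (simp add: \<gamma>)
      also have "\<dots> = (sqrt \<gamma> * norm v)\<^sup>2"
        using \<gamma> by (simp add: power_mult_distrib field_simps)
      finally show ?thesis by (rule power2_le_imp_le) (use \<gamma> in simp)
    qed
    have RH: "closed_loop M N (rmat K) \<in> RH_inf"
      unfolding closed_loop_eq X_def[symmetric] using X by (intro RH_inf_vstack RH_inf_mult rmat_RH_inf)
    have "spectral_norm (eval_mat (closed_loop M N (rmat K)) z) \<le> sqrt \<gamma>" if "Re z > 0" for z
      unfolding spectral_norm_def by (rule onorm_le, rule RH_inf_gain_bound[OF RH axis that])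
    then show ?thesis
      unfolding Hinf_norm_def by (intro SUP_least) simp
  qed
  have lower: "ereal (sqrt \<gamma>) \<le> Hinf_norm (closed_loop M N K')" if "K' \<in> feasible M N" for K'
  proof (rule ereal_le_real)
    fix h assume h: "Hinf_norm (closed_loop M N K') \<le> ereal h"
    define Y where "Y = matrix_inv (M - N ** K')"
    have K': "regular_at K' 0" and Y: "invertible (M - N ** K')" "regular_at Y 0"
      using that by (simp_all add: feasible_def stabilizing_def Y_def RH_inf_iff RL_inf_regular_at)
    note val = closed_loop_value[OF Y_def[symmetric] Y(1) regMN K' Y(2)]
    let ?T = "eval_mat (closed_loop M N K') 0"
    have T: "norm (?T *v v) \<le> h * norm v" for v
      by (rule Hinf_norm_bound[OF h val(1)]) simp
    \<comment> \<open>At \<open>0\<close> the term with \<open>E\<close> drops out, which leaves a right inverse of \<open>[A B]\<close> up to sign.\<close>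
    have "(0 *\<^sub>m cmat E - cmat A - cmat B ** eval_mat K' 0) ** eval_mat Y 0 = mat 1"
      using val(3) by (simp add: M N eval_mat_pencil)
    then have one: "- (cmat A ** eval_mat Y 0) - cmat B ** (eval_mat K' 0 ** eval_mat Y 0) = mat 1"
      unfolding matrix_diff_rdistrib scale_mat_mult_left unfolding scale_mat_0
      by (simp add: matrix_mul_assoc)
    have "adjoint_mat L ** ?T = - mat 1"
      unfolding val(2) adjL by (simp flip: one)
    note bound = gain_lower_bound[OF gram GGi Gi_sym this T]
    have "\<gamma> \<le> h\<^sup>2"
      unfolding \<gamma>_def spectral_norm_def
    proof (rule onorm_le)
      fix x :: "real^'k"
      show "norm (matrix_inv G *v x) \<le> h\<^sup>2 * norm x"
        using bound[of "\<chi> i. complex_of_real (x $ i)"]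
        by (simp add: Gi_def norm_cmat_mult_vec norm_of_real_vec)
    qed
    moreover have "0 \<le> h"
      using T[of 1] order_trans[OF norm_ge_zero T[of 1]] by (simp add: zero_le_mult_iff)
    ultimately show "ereal (sqrt \<gamma>) \<le> ereal h" by (simp add: real_le_lsqrt)
  qed

  have "Hinf_norm (closed_loop M N (rmat K)) = Hinf_optimum M N"
    unfolding Hinf_optimum_def
  proof (rule antisym)
    show "Hinf_norm (closed_loop M N (rmat K)) \<le> (INF K'\<in>feasible M N. Hinf_norm (closed_loop M N K'))"
      using upper lower by (intro INF_greatest) (rule order_trans)
    show "(INF K'\<in>feasible M N. Hinf_norm (closed_loop M N K')) \<le> Hinf_norm (closed_loop M N (rmat K))"
      using feasible by (rule INF_lower)
  qed
  with feasible show ?thesis by (simp add: solves_Hinf_problem_def)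
qed

end
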